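(* Let $\mathcal X\subset\mathbb R^d$ be a compact convex set of diameter $D$, let $L>0$, $\gamma\in(0,1]$, and let $f:\mathbb R^d\to\mathbb R$ be $L$-smooth in $\mathcal X$ and $\gamma$-quasar convex in $\mathcal X$ with center $x^\ast\in\mathcal X$. Let $x_0\in\mathcal X$ and let $(x_t)_{t\ge0}$ be the iterates of the Frank-Wolfe algorithm $$v_t\in\arg\min_{v\in\mathcal X}\langle\nabla f(x_t),v\rangle,\qquad x_{t+1}=(1-\eta_t)x_t+\eta_tv_t,\qquad t\ge0,$$ where the step sizes are chosen, for the whole execution, by one of the following two rules: (a) $\eta_t=\dfrac{a_t/\gamma}{A_{t-1}+a_t/\gamma}$, with $a_t=2t+2$, $A_{-1}=0$, and $A_t=\sum_{i=0}^ta_i=(t+1)(t+2)$; (b) (short steps) $\eta_t=\min\left\{1,\dfrac{\langle\nabla f(x_t),x_t-v_t\rangle}{L\|v_t-x_t\|_2^2}\right\}$. Then, for either of the two rules and for all $t\ge1$, $$f(x_t)-f(x^\ast)\le\frac{6LD^2}{(t+1)\gamma^2}.$$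
   Context: A function is differentiable on a closed set $\mathcal X$ if it is differentiable in an open neighborhood of $\mathcal X$. A differentiable $f$ is $L$-smooth in $\mathcal X$ if $\|\nabla f(x)-\nabla f(y)\|_2\le L\|x-y\|_2$ for all $x,y\in\mathcal X$. For $\gamma\in(0,1]$, $f$ is $\gamma$-quasar convex in $\mathcal X$ with center $x^\ast\in\mathcal X$ if $x^\ast\in\arg\min_{x\in\mathcal X}f(x)$ and $f(x^\ast)\ge f(x)+\frac1\gamma\langle\nabla f(x),x^\ast-x\rangle$ for all $x\in\mathcal X$. The diameter is with respect to $\|\cdot\|_2$. The short step in (b) equals $\arg\min_{\eta\in[0,1]}\{\eta\langle\nabla f(x_t),v_t-x_t\rangle+\frac{L\eta^2}2\|v_t-x_t\|_2^2\}$; if $v_t=x_t$, any $\eta_t\in[0,1]$ may be used (then $x_{t+1}=x_t$). *)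

theory Defs
  imports "HOL-Analysis.Analysis"
begin

definition gradient :: "('a::euclidean_space \<Rightarrow> real) \<Rightarrow> 'a \<Rightarrow> 'a" where
  "gradient f x = (THE g. GDERIV f x :> g)"

lemma gradient_eqI:
  fixes f :: "'a::euclidean_space \<Rightarrow> real"
  assumes "GDERIV f x :> g"
  shows "gradient f x = g"
proof -
  have "g' = g" if "GDERIV f x :> g'" for g'
  proof -
    have "(\<lambda>h. h \<bullet> g') = (\<lambda>h. h \<bullet> g)"
      using has_derivative_unique that assms unfolding gderiv_def by blast
    then have "h \<bullet> g' = h \<bullet> g" for h
      by meson
    then show ?thesis
      using vector_eq_ldot by blast
  qed
  with assms show ?thesis
    unfolding gradient_def by (blast intro: the_equality)
qed

lemma gderiv_gradient:
  fixes f :: "'a::euclidean_space \<Rightarrow> real"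
  assumes "f differentiable (at x)"
  shows "GDERIV f x :> gradient f x"
proof -
  from assms obtain f' where f': "(f has_derivative f') (at x)"
    unfolding differentiable_def by blast
  then have lin: "linear f'"
    by (rule has_derivative_linear)
  have "f' = (\<lambda>h. h \<bullet> (\<Sum>b\<in>Basis. f' b *\<^sub>R b))"
  proof
    fix h
    have "f' h = f' (\<Sum>b\<in>Basis. (h \<bullet> b) *\<^sub>R b)"
      by (simp add: euclidean_representation)
    also have "\<dots> = (\<Sum>b\<in>Basis. (h \<bullet> b) * f' b)"
      using lin by (simp add: linear_sum linear_cmul)
    also have "\<dots> = h \<bullet> (\<Sum>b\<in>Basis. f' b *\<^sub>R b)"
      by (simp add: inner_sum_right mult.commute)
    finally show "f' h = h \<bullet> (\<Sum>b\<in>Basis. f' b *\<^sub>R b)" .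
  qed
  with f' have "GDERIV f x :> (\<Sum>b\<in>Basis. f' b *\<^sub>R b)"
    unfolding gderiv_def by simp
  then show ?thesis
    using gradient_eqI by metis
qed

definition differentiable_near :: "('a::euclidean_space \<Rightarrow> real) \<Rightarrow> 'a set \<Rightarrow> bool" where
  "differentiable_near f X \<longleftrightarrow> (\<exists>U. open U \<and> X \<subseteq> U \<and> f differentiable_on U)"

definition smooth_in :: "real \<Rightarrow> ('a::euclidean_space \<Rightarrow> real) \<Rightarrow> 'a set \<Rightarrow> bool" where
  "smooth_in L f X \<longleftrightarrow> differentiable_near f X \<and>
     (\<forall>x\<in>X. \<forall>y\<in>X. norm (gradient f x - gradient f y) \<le> L * norm (x - y))"

definition quasar_convex_in ::
  "real \<Rightarrow> ('a::euclidean_space \<Rightarrow> real) \<Rightarrow> 'a set \<Rightarrow> 'a \<Rightarrow> bool" where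
  "quasar_convex_in \<gamma> f X xs \<longleftrightarrow>
     is_arg_min f (\<lambda>x. x \<in> X) xs \<and>
     (\<forall>x\<in>X. f xs \<ge> f x + (1 / \<gamma>) * (gradient f x \<bullet> (xs - x)))"

definition frank_wolfe ::
  "('a::euclidean_space \<Rightarrow> real) \<Rightarrow> 'a set \<Rightarrow> (nat \<Rightarrow> real) \<Rightarrow> (nat \<Rightarrow> 'a) \<Rightarrow> (nat \<Rightarrow> 'a) \<Rightarrow> bool" where
  "frank_wolfe f X \<eta> x v \<longleftrightarrow> x 0 \<in> X \<and>
     (\<forall>t. is_arg_min (\<lambda>w. gradient f (x t) \<bullet> w) (\<lambda>w. w \<in> X) (v t) \<and>
          x (Suc t) = (1 - \<eta> t) *\<^sub>R x t + \<eta> t *\<^sub>R v t)"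

definition fw_a :: "nat \<Rightarrow> real" where
  "fw_a t = 2 * real t + 2"

(* fw_A_prev t is A_{t-1}; the shift of the index makes A_{-1} = 0 the empty sum. *)
definition fw_A_prev :: "nat \<Rightarrow> real" where
  "fw_A_prev t = (\<Sum>i<t. fw_a i)"

lemma fw_A_prev_Suc: "fw_A_prev (Suc t) = (real t + 1) * (real t + 2)"
  unfolding fw_A_prev_def fw_a_def by (induction t) (auto simp: algebra_simps)

definition open_loop_steps :: "real \<Rightarrow> (nat \<Rightarrow> real) \<Rightarrow> bool" where
  "open_loop_steps \<gamma> \<eta> \<longleftrightarrow> (\<forall>t. \<eta> t = (fw_a t / \<gamma>) / (fw_A_prev t + fw_a t / \<gamma>))"

(* When v t = x t the quotient is undefined and every step size in [0,1] is admissible. *)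
definition short_steps ::
  "real \<Rightarrow> ('a::euclidean_space \<Rightarrow> real) \<Rightarrow> (nat \<Rightarrow> 'a) \<Rightarrow> (nat \<Rightarrow> 'a) \<Rightarrow> (nat \<Rightarrow> real) \<Rightarrow> bool" where
  "short_steps L f x v \<eta> \<longleftrightarrow>
     (\<forall>t. if v t = x t then \<eta> t \<in> {0..1}
          else \<eta> t = min 1 ((gradient f (x t) \<bullet> (x t - v t)) / (L * (norm (v t - x t))\<^sup>2)))"

end

theory Submission
  imports Defs
begin

text \<open>
  Writing \<open>h\<^sub>t = f x\<^sub>t - f x\<^sup>*\<close>, the descent lemma, the choice of \<open>v\<^sub>t\<close> and quasar convexity give
  \<open>h\<^sub>t\<^sub>+\<^sub>1 \<le> (1 - \<alpha>\<gamma>) h\<^sub>t + L D\<^sup>2 \<alpha>\<^sup>2 / 2\<close> with \<open>\<alpha>\<close> the open-loop step \<open>2 / (\<gamma>t + 2)\<close>; a short step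
  decreases the quadratic model at least as much as \<open>\<alpha>\<close> does, so the recursion holds for both rules.
  In terms of \<open>s = t + 2/\<gamma>\<close> it reads \<open>h' \<le> (1 - 2/s) h + M / s\<^sup>2\<close>, \<open>M = 2 L D\<^sup>2 / \<gamma>\<^sup>2\<close>, and it preserves
  \<open>h \<le> K / s\<close> for every \<open>K \<ge> M\<close>. At \<open>t = 0\<close> one has \<open>\<alpha> = 1\<close>, which bounds \<open>h\<^sub>1\<close> by \<open>2 L D\<^sup>2\<close>
  independently of \<open>h\<^sub>0\<close>, so \<open>K = 6 L D\<^sup>2 / \<gamma>\<^sup>2\<close> works from \<open>t = 1\<close> on.
\<close>

section \<open>Quadratic bounds from Lipschitz gradients\<close>

lemma descent_lemma:
  fixes f :: "'a::euclidean_space \<Rightarrow> real"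
  assumes "smooth_in L f X" "convex X" "x \<in> X" "y \<in> X"
  shows "f y \<le> f x + gradient f x \<bullet> (y - x) + L / 2 * (norm (y - x))\<^sup>2"
proof -
  define d where "d = y - x"
  \<comment> \<open>Along the segment, \<open>\<psi> s\<close> is \<open>f\<close> minus the
    nonconstant part of its quadratic upper model. Convexity keeps the segment in \<open>X\<close>,
    where the Lipschitz bound makes the derivative of \<open>\<psi>\<close> nonpositive.\<close>
  define \<psi> where "\<psi> s = f (x + s *\<^sub>R d) - s * (gradient f x \<bullet> d) - L / 2 * s\<^sup>2 * (norm d)\<^sup>2" for s
  have "\<psi> 1 \<le> \<psi> 0"
  proof (rule DERIV_nonpos_imp_nonincreasing[where f = \<psi>])
    fix s :: real
    assume "0 \<le> s" "s \<le> 1"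
    define z where "z = x + s *\<^sub>R d"
    have "z = (1 - s) *\<^sub>R x + s *\<^sub>R y"
      by (simp add: z_def d_def algebra_simps)
    then have "z \<in> X"
      using assms \<open>0 \<le> s\<close> \<open>s \<le> 1\<close> by (simp add: convexD)
    moreover obtain U where "open U" "X \<subseteq> U" "f differentiable_on U"
      using assms(1) unfolding smooth_in_def differentiable_near_def by blast
    ultimately have "f differentiable (at z)"
      by (meson differentiable_on_eq_differentiable_at subsetD)
    then have "(f has_derivative (\<lambda>h. h \<bullet> gradient f z)) (at (x + s *\<^sub>R d))"
      using gderiv_gradient unfolding gderiv_def z_def by blast
    then have "((\<lambda>s. f (x + s *\<^sub>R d)) has_derivative (\<lambda>h. (h *\<^sub>R d) \<bullet> gradient f z)) (at s)"
      by (rule has_derivative_compose[rotated]) (auto intro!: derivative_eq_intros)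
    then have "((\<lambda>s. f (x + s *\<^sub>R d)) has_real_derivative gradient f z \<bullet> d) (at s)"
      unfolding has_field_derivative_def by (simp add: inner_commute mult_commute_abs)
    then have "(\<psi> has_real_derivative
        gradient f z \<bullet> d - gradient f x \<bullet> d - L * s * (norm d)\<^sup>2) (at s)"
      unfolding \<psi>_def by (auto intro!: derivative_eq_intros)
    moreover have "gradient f z \<bullet> d - gradient f x \<bullet> d \<le> L * s * (norm d)\<^sup>2"
    proof -
      have "gradient f z \<bullet> d - gradient f x \<bullet> d \<le> norm (gradient f z - gradient f x) * norm d"
        by (metis inner_diff_left norm_cauchy_schwarz)
      also have "\<dots> \<le> (L * norm (z - x)) * norm d"
        using assms \<open>z \<in> X\<close> unfolding smooth_in_def by (intro mult_right_mono) auto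
      finally show ?thesis
        using \<open>0 \<le> s\<close> by (simp add: z_def power2_eq_square mult.assoc)
    qed
    ultimately show "\<exists>u. (\<psi> has_real_derivative u) (at s) \<and> u \<le> 0"
      by (intro exI conjI) auto
  qed simp
  then show ?thesis
    by (simp add: \<psi>_def d_def)
qed

text \<open>Apply the descent lemma from \<open>y\<close> to \<open>x\<close>, then replace the
  gradient at \<open>y\<close> by that at \<open>x\<close> at the cost of one Lipschitz term: 3/2 =
  1/2 + 1. This controls the first iterate, where quasar convexity would leave a multiple of the
  initial gap.\<close>

lemma smooth_lower_bound:
  fixes f :: "'a::euclidean_space \<Rightarrow> real"
  assumes "smooth_in L f X" "convex X" "x \<in> X" "y \<in> X"
  shows "f x + gradient f x \<bullet> (y - x) \<le> f y + 3 / 2 * L * (norm (y - x))\<^sup>2"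
proof -
  have "f x \<le> f y + gradient f y \<bullet> (x - y) + L / 2 * (norm (y - x))\<^sup>2"
    using descent_lemma[OF assms(1,2,4,3)] by (simp add: norm_minus_commute)
  moreover have "(gradient f x - gradient f y) \<bullet> (y - x) \<le> L * (norm (y - x))\<^sup>2"
  proof -
    have "(gradient f x - gradient f y) \<bullet> (y - x)
        \<le> norm (gradient f x - gradient f y) * norm (y - x)"
      by (rule norm_cauchy_schwarz)
    also have "\<dots> \<le> (L * norm (x - y)) * norm (y - x)"
      using assms unfolding smooth_in_def by (intro mult_right_mono) auto
    finally show ?thesis
      by (simp add: norm_minus_commute power2_eq_square mult.assoc)
  qed
  ultimately show ?thesis
    by (simp add: inner_diff_left inner_diff_right)
qed

section \<open>Step sizes and the decrease in one step\<close>

lemma quadratic_min_unit_interval: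
  fixes p q \<alpha> :: real
  assumes "q > 0" "0 \<le> \<alpha>" "\<alpha> \<le> 1"
  defines "\<eta> \<equiv> min 1 (p / q)"
  shows "- \<eta> * p + \<eta>\<^sup>2 * q / 2 \<le> - \<alpha> * p + \<alpha>\<^sup>2 * q / 2"
proof (cases "p \<le> q")
  case True
  then have "p = \<eta> * q"
    using \<open>q > 0\<close> by (simp add: \<eta>_def)
  \<comment> \<open>\<open>\<eta>\<close> is the vertex \<open>p / q\<close> of the parabola, so the
    excess at \<open>\<alpha>\<close> is a square.\<close>
  then have "- \<alpha> * p + \<alpha>\<^sup>2 * q / 2 - (- \<eta> * p + \<eta>\<^sup>2 * q / 2) = q * (\<alpha> - \<eta>)\<^sup>2 / 2"
    by (simp add: power2_eq_square field_simps)
  moreover have "0 \<le> q * (\<alpha> - \<eta>)\<^sup>2 / 2"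
    using \<open>q > 0\<close> by simp
  ultimately show ?thesis
    by linarith
next
  case False
  then have "\<eta> = 1"
    using \<open>q > 0\<close> by (simp add: \<eta>_def)
  \<comment> \<open>The excess of the value at \<open>\<alpha>\<close> over the value at 1 is
    \<open>(1 - \<alpha>) * (p - (1 + \<alpha>) / 2 * q)\<close>.\<close>
  have "(1 + \<alpha>) / 2 * q \<le> 1 * q"
    using assms by (intro mult_right_mono) auto
  with False have "0 \<le> (1 - \<alpha>) * (p - (1 + \<alpha>) / 2 * q)"
    using \<open>\<alpha> \<le> 1\<close> by (intro mult_nonneg_nonneg) auto
  then show ?thesis
    unfolding \<open>\<eta> = 1\<close> by (simp add: power2_eq_square field_simps)
qed

text \<open>\<open>fw_A_prev t\<close> is \<open>t * (t + 1)\<close>, so the factor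
  \<open>(t + 1) / \<gamma>\<close> cancels; in particular the first step is 1.\<close>

lemma open_loop_steps_eq:
  assumes "open_loop_steps \<gamma> \<eta>" "\<gamma> > 0"
  shows "\<eta> t = 2 / (\<gamma> * real t + 2)"
proof -
  have A: "fw_A_prev t = real t * (real t + 1)"
    by (cases t) (auto simp: fw_A_prev_Suc fw_A_prev_def[of 0] algebra_simps)
  have pos: "real t + 1 > 0" "\<gamma> * real t + 2 > 0"
    using \<open>\<gamma> > 0\<close> by (auto intro: add_nonneg_pos)
  have "\<eta> t = (2 * (real t + 1) / \<gamma>) / (real t * (real t + 1) + 2 * (real t + 1) / \<gamma>)"
    using assms by (simp add: open_loop_steps_def fw_a_def A algebra_simps)
  also have "real t * (real t + 1) + 2 * (real t + 1) / \<gamma> = (real t + 1) / \<gamma> * (\<gamma> * real t + 2)"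
    using \<open>\<gamma> > 0\<close> by (simp add: field_simps)
  also have "2 * (real t + 1) / \<gamma> = (real t + 1) / \<gamma> * 2"
    by simp
  also have "(real t + 1) / \<gamma> * 2 / ((real t + 1) / \<gamma> * (\<gamma> * real t + 2)) = 2 / (\<gamma> * real t + 2)"
    using pos \<open>\<gamma> > 0\<close> by (intro mult_divide_mult_cancel_left) auto
  finally show ?thesis .
qed

lemma frank_wolfe_minimizer:
  assumes "frank_wolfe f X \<eta> x v"
  shows "v t \<in> X" and "w \<in> X \<Longrightarrow> gradient f (x t) \<bullet> v t \<le> gradient f (x t) \<bullet> w"
  using assms unfolding frank_wolfe_def is_arg_min_linorder by auto

text \<open>A short step is nonnegative because \<open>v t\<close> is compared with
  \<open>x t\<close> itself, which requires \<open>x t \<in> X\<close>; feasibility of the iterates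
  is then proved by induction.\<close>

lemma frank_wolfe_step_in_unit_interval:
  assumes fw: "frank_wolfe f X \<eta> x v" and "L > 0" "\<gamma> > 0" "x t \<in> X"
    and steps: "open_loop_steps \<gamma> \<eta> \<or> short_steps L f x v \<eta>"
  shows "\<eta> t \<in> {0..1}"
  using steps
proof
  assume "open_loop_steps \<gamma> \<eta>"
  then show ?thesis
    using \<open>\<gamma> > 0\<close> by (simp add: open_loop_steps_eq pos_divide_le_eq add_nonneg_pos)
next
  assume short: "short_steps L f x v \<eta>"
  have "0 \<le> gradient f (x t) \<bullet> (x t - v t)"
    using frank_wolfe_minimizer(2)[OF fw \<open>x t \<in> X\<close>] by (simp add: inner_diff_right)
  then show ?thesis
    using short \<open>L > 0\<close> unfolding short_steps_def by (auto split: if_splits dest: spec[of _ t])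
qed

lemma frank_wolfe_iterate_in:
  assumes fw: "frank_wolfe f X \<eta> x v" and "convex X" "L > 0" "\<gamma> > 0"
    and steps: "open_loop_steps \<gamma> \<eta> \<or> short_steps L f x v \<eta>"
  shows "x t \<in> X"
proof (induction t)
  case 0
  then show ?case
    using fw by (simp add: frank_wolfe_def)
next
  case (Suc t)
  have "\<eta> t \<in> {0..1}"
    by (rule frank_wolfe_step_in_unit_interval[OF fw \<open>L > 0\<close> \<open>\<gamma> > 0\<close> Suc steps])
  then have "(1 - \<eta> t) *\<^sub>R x t + \<eta> t *\<^sub>R v t \<in> X"
    using \<open>convex X\<close> Suc frank_wolfe_minimizer(1)[OF fw] by (intro convexD) auto
  then show ?case
    using fw by (simp add: frank_wolfe_def)
qed

text \<open>First \<open>\<eta> t\<close> is exchanged for \<open>\<alpha> t\<close> at fixed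
  \<open>v t\<close>, then \<open>v t\<close> for \<open>w\<close> by its minimality. Without quasar
  convexity, the estimate serves both the first step and the later ones.\<close>

lemma frank_wolfe_step_decrease:
  assumes fw: "frank_wolfe f X \<eta> x v" and X: "convex X" "bounded X"
    and "L > 0" "\<gamma> > 0"
    and smooth: "smooth_in L f X"
    and steps: "open_loop_steps \<gamma> \<eta> \<or> short_steps L f x v \<eta>"
    and "w \<in> X"
  defines "\<alpha> \<equiv> \<lambda>t. 2 / (\<gamma> * real t + 2)"
  shows "f (x (Suc t)) \<le> f (x t) + \<alpha> t * (gradient f (x t) \<bullet> (w - x t))
           + (\<alpha> t)\<^sup>2 * (L * (diameter X)\<^sup>2) / 2"
proof -
  have xX: "x t \<in> X" for t
    by (rule frank_wolfe_iterate_in[OF fw X(1) \<open>L > 0\<close> \<open>\<gamma> > 0\<close> steps])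
  define p where "p = gradient f (x t) \<bullet> (x t - v t)"
  define q where "q = L * (norm (v t - x t))\<^sup>2"
  have \<alpha>: "0 \<le> \<alpha> t" "\<alpha> t \<le> 1"
    using \<open>\<gamma> > 0\<close> by (simp_all add: \<alpha>_def pos_divide_le_eq add_nonneg_pos)
  have diff: "x (Suc t) - x t = \<eta> t *\<^sub>R (v t - x t)"
    using fw by (simp add: frank_wolfe_def algebra_simps)
  have "f (x (Suc t)) \<le> f (x t) + (- \<eta> t * p + (\<eta> t)\<^sup>2 * q / 2)"
    using descent_lemma[OF smooth X(1) xX xX, of "Suc t" t] unfolding diff
    by (simp add: p_def q_def power_mult_distrib inner_diff_right right_diff_distrib mult_ac)
  also have "- \<eta> t * p + (\<eta> t)\<^sup>2 * q / 2 \<le> - \<alpha> t * p + (\<alpha> t)\<^sup>2 * q / 2"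
    using steps
  proof
    assume "open_loop_steps \<gamma> \<eta>"
    then show ?thesis
      using \<open>\<gamma> > 0\<close> by (simp add: open_loop_steps_eq \<alpha>_def)
  next
    assume short: "short_steps L f x v \<eta>"
    show ?thesis
    proof (cases "v t = x t")
      \<comment> \<open>Any step is allowed here, but \<open>p\<close> and \<open>q\<close> both
        vanish.\<close>
      case True
      then show ?thesis
        by (simp add: p_def q_def)
    next
      case False
      then have "q > 0" "\<eta> t = min 1 (p / q)"
        using short \<open>L > 0\<close> by (auto simp: short_steps_def p_def q_def)
      then show ?thesis
        using quadratic_min_unit_interval[OF _ \<alpha>] by simp
    qed
  qed
  also have "- \<alpha> t * p \<le> \<alpha> t * (gradient f (x t) \<bullet> (w - x t))"
    using mult_left_mono[OF frank_wolfe_minimizer(2)[OF fw \<open>w \<in> X\<close>] \<alpha>(1), of t]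
    by (simp add: p_def inner_diff_right algebra_simps)
  also have "(\<alpha> t)\<^sup>2 * q \<le> (\<alpha> t)\<^sup>2 * (L * (diameter X)\<^sup>2)"
  proof -
    have "norm (v t - x t) \<le> diameter X"
      using diameter_bounded_bound[OF X(2) frank_wolfe_minimizer(1)[OF fw] xX]
      by (simp add: dist_norm)
    then have "(norm (v t - x t))\<^sup>2 \<le> (diameter X)\<^sup>2"
      by (rule power_mono) simp
    then show ?thesis
      using \<open>L > 0\<close> unfolding q_def by (intro mult_left_mono) auto
  qed
  finally show ?thesis
    by (simp add: algebra_simps)
qed

section \<open>Solving the recursion\<close>

lemma inverse_linear_rate_step:
  fixes h h' s K M :: real
  assumes "s \<ge> 2" "0 \<le> M" "M \<le> K" "h \<le> K / s" "h' \<le> (1 - 2 / s) * h + M / s\<^sup>2"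
  shows "h' \<le> K / (s + 1)"
proof -
  have "h' \<le> (1 - 2 / s) * (K / s) + M / s\<^sup>2"
    using assms mult_left_mono[of h "K / s" "1 - 2 / s"] by simp
  also have "\<dots> = (K * (s - 2) + M) / s\<^sup>2"
    using \<open>s \<ge> 2\<close> by (simp add: power2_eq_square field_simps)
  also have "\<dots> \<le> K / (s + 1)"
  proof -
    \<comment> \<open>The numerator is at most \<open>K * (s - 1)\<close>, and
      \<open>(s - 1) * (s + 1)\<close> is below the square of \<open>s\<close>.\<close>
    have "M * (s + 1) \<le> K * (s + 1)"
      using assms by (intro mult_right_mono) auto
    then have "(K * (s - 2) + M) * (s + 1) \<le> K * s\<^sup>2"
      using assms by (simp add: power2_eq_square algebra_simps)
    then show ?thesis
      using \<open>s \<ge> 2\<close> by (simp add: divide_le_eq pos_le_divide_eq mult.commute)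
  qed
  finally show ?thesis .
qed

theorem theorem9:
  fixes X :: "(real ^ 'd) set"
    and f :: "real ^ 'd \<Rightarrow> real"
    and D L \<gamma> :: real
    and xs :: "real ^ 'd"
    and x v :: "nat \<Rightarrow> real ^ 'd"
    and \<eta> :: "nat \<Rightarrow> real"
  assumes "compact X" and "convex X" and "D = diameter X"
    and "L > 0" and "0 < \<gamma>" and "\<gamma> \<le> 1"
    and "smooth_in L f X"
    and "quasar_convex_in \<gamma> f X xs"
    and "frank_wolfe f X \<eta> x v"
    and "open_loop_steps \<gamma> \<eta> \<or> short_steps L f x v \<eta>"
  shows "\<forall>t\<ge>1. f (x t) - f xs \<le> 6 * L * D\<^sup>2 / ((real t + 1) * \<gamma>\<^sup>2)"
proof -
  note fw = \<open>frank_wolfe f X \<eta> x v\<close>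
  define C where "C = L * D\<^sup>2"
  define s where "s t = real t + 2 / \<gamma>" for t
  define h where "h t = f (x t) - f xs" for t
  have "C \<ge> 0"
    using \<open>L > 0\<close> by (simp add: C_def)
  have "bounded X"
    using \<open>compact X\<close> by (rule compact_imp_bounded)
  have "xs \<in> X"
    using assms(8) unfolding quasar_convex_in_def is_arg_min_def by blast
  have xX: "x t \<in> X" for t
    by (rule frank_wolfe_iterate_in[OF fw \<open>convex X\<close> \<open>L > 0\<close> \<open>0 < \<gamma>\<close> assms(10)])
  have decrease: "h (Suc t) \<le> h t + 2 / (\<gamma> * real t + 2) * (gradient f (x t) \<bullet> (xs - x t))
      + (2 / (\<gamma> * real t + 2))\<^sup>2 * C / 2" for t
    using frank_wolfe_step_decrease[OF fw \<open>convex X\<close> \<open>bounded X\<close> \<open>L > 0\<close> \<open>0 < \<gamma>\<close> assms(7,10)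
        \<open>xs \<in> X\<close>, of t]
    by (simp add: h_def C_def \<open>D = diameter X\<close>)

  \<comment> \<open>With unit step \<open>\<alpha>\<close>, \<open>h 0\<close> occurs only together
    with the linear term, and the lower bound caps the sum by 3/2 \<open>C\<close>; the model adds
    \<open>C / 2\<close>.\<close>
  have "h 1 \<le> 2 * C"
  proof -
    have "norm (xs - x 0) \<le> D"
      using diameter_bounded_bound[OF \<open>bounded X\<close> \<open>xs \<in> X\<close> xX]
      by (simp add: dist_norm \<open>D = diameter X\<close>)
    then have "L * (norm (xs - x 0))\<^sup>2 \<le> C"
      using \<open>L > 0\<close> unfolding C_def by (intro mult_left_mono power_mono) auto
    then have "h 0 + gradient f (x 0) \<bullet> (xs - x 0) \<le> 3 / 2 * C"
      using smooth_lower_bound[OF assms(7) \<open>convex X\<close> xX \<open>xs \<in> X\<close>, of 0] by (simp add: h_def)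
    then show ?thesis
      using decrease[of 0] by simp
  qed

  have rate: "h (Suc t) \<le> (6 * C / \<gamma>\<^sup>2) / s (Suc t)" for t
  proof (induction t)
    case 0
    \<comment> \<open>This fixes the constant 6 = 2 * 3; the inductive step would accept any
      constant from \<open>2 * C / \<gamma>\<^sup>2\<close> upwards.\<close>
    have "\<gamma>\<^sup>2 * s 1 = \<gamma>\<^sup>2 + 2 * \<gamma>"
      using \<open>0 < \<gamma>\<close> by (simp add: s_def power2_eq_square algebra_simps)
    moreover have "\<gamma>\<^sup>2 \<le> 1"
      using \<open>0 < \<gamma>\<close> \<open>\<gamma> \<le> 1\<close> by (simp add: power_le_one)
    ultimately have "\<gamma>\<^sup>2 * s 1 \<le> 3" "\<gamma>\<^sup>2 * s 1 > 0"
      using \<open>0 < \<gamma>\<close> \<open>\<gamma> \<le> 1\<close> by (auto intro: add_pos_pos)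
    moreover from this have "2 * C * (\<gamma>\<^sup>2 * s 1) \<le> 2 * C * 3"
      using \<open>C \<ge> 0\<close> by (intro mult_left_mono) auto
    ultimately have "2 * C \<le> 6 * C / (\<gamma>\<^sup>2 * s 1)"
      by (simp add: pos_le_divide_eq)
    with \<open>h 1 \<le> 2 * C\<close> show ?case
      by simp
  next
    case (Suc t)
    define r where "r = s (Suc t)"
    have "2 / \<gamma> \<ge> 2"
      using \<open>0 < \<gamma>\<close> \<open>\<gamma> \<le> 1\<close> by (simp add: pos_le_divide_eq)
    then have "r \<ge> 2"
      by (simp add: r_def s_def)
    \<comment> \<open>The shift \<open>2 / \<gamma>\<close> in \<open>s\<close> turns the step into
      \<open>2 / (\<gamma> * r)\<close>; quasar convexity then cancels \<open>\<gamma>\<close> in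
      the linear term, leaving the factor \<open>1 - 2 / r\<close>.\<close>
    have "\<gamma> * real (Suc t) + 2 = \<gamma> * r"
      using \<open>0 < \<gamma>\<close> by (simp add: r_def s_def field_simps)
    then have "h (Suc (Suc t)) \<le> h (Suc t) + 2 / (\<gamma> * r) * (gradient f (x (Suc t)) \<bullet> (xs - x (Suc t)))
        + (2 / (\<gamma> * r))\<^sup>2 * C / 2"
      using decrease[of "Suc t"] by simp
    also have "gradient f (x (Suc t)) \<bullet> (xs - x (Suc t)) \<le> - \<gamma> * h (Suc t)"
    proof -
      have "1 / \<gamma> * (gradient f (x (Suc t)) \<bullet> (xs - x (Suc t))) \<le> - h (Suc t)"
        using assms(8) xX[of "Suc t"] by (force simp: quasar_convex_in_def h_def)
      then show ?thesis
        using \<open>0 < \<gamma>\<close> by (simp add: pos_divide_le_eq mult.commute)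
    qed
    also have "h (Suc t) + 2 / (\<gamma> * r) * (- \<gamma> * h (Suc t)) + (2 / (\<gamma> * r))\<^sup>2 * C / 2
        = (1 - 2 / r) * h (Suc t) + (2 * C / \<gamma>\<^sup>2) / r\<^sup>2"
      using \<open>0 < \<gamma>\<close> \<open>r \<ge> 2\<close> by (simp add: power2_eq_square field_simps)
    finally have "h (Suc (Suc t)) \<le> (1 - 2 / r) * h (Suc t) + (2 * C / \<gamma>\<^sup>2) / r\<^sup>2"
      using \<open>0 < \<gamma>\<close> \<open>r \<ge> 2\<close> by (simp add: divide_right_mono)
    then have "h (Suc (Suc t)) \<le> (6 * C / \<gamma>\<^sup>2) / (r + 1)"
      using \<open>r \<ge> 2\<close> \<open>C \<ge> 0\<close> Suc
      by (intro inverse_linear_rate_step[where h = "h (Suc t)" and M = "2 * C / \<gamma>\<^sup>2"])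
        (auto simp: r_def intro!: divide_right_mono)
    then show ?case
      by (simp add: r_def s_def add_ac)
  qed

  show ?thesis
  proof (intro allI impI)
    fix t :: nat
    assume "t \<ge> 1"
    \<comment> \<open>The sharper denominator \<open>t + 2 / \<gamma>\<close> is weakened to
      \<open>t + 1\<close>.\<close>
    have "1 \<le> 2 / \<gamma>"
      using \<open>0 < \<gamma>\<close> \<open>\<gamma> \<le> 1\<close> by (simp add: pos_le_divide_eq)
    have "h t \<le> (6 * C / \<gamma>\<^sup>2) / s t"
      using rate[of "t - 1"] \<open>t \<ge> 1\<close> by simp
    also have "\<dots> \<le> (6 * C / \<gamma>\<^sup>2) / (real t + 1)"
      using \<open>C \<ge> 0\<close> \<open>1 \<le> 2 / \<gamma>\<close> by (intro divide_left_mono) (auto simp: s_def)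
    finally show "f (x t) - f xs \<le> 6 * L * D\<^sup>2 / ((real t + 1) * \<gamma>\<^sup>2)"
      by (simp add: h_def C_def mult_ac)
  qed
qed

end
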